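(* Let $C$ be a $\mathbb Z$-filtered chain complex over a commutative ring $\mathbb K$. Extend the $\mathbb Z$-filtration to an $\mathbb R$-filtration on $C$ by the formula $F_sC=F_{\lfloor s\rfloor}C$ for $s\in\mathbb R$. Then for every natural number $r\ge1$, every integer $\ell$ and every $n$, $$E^r_{\ell,n-\ell}(C)=\mathrm{SH}^{r-1}_{n,(\ell-1,\ell]}(C)=\mathrm{SH}^{r-1}_{n,\{\ell\}}(C).$$
   Context: A $\mathbb Z$-filtered chain complex $C$ has subcomplexes $\dots\subseteq F_{-1}C\subseteq F_0C\subseteq F_1C\subseteq\dots\subseteq C$ (no further assumption on the filtration). Write $F_\ell=F_\ell C$. The pages of the associated spectral sequence are $E^r_{\ell,n-\ell}(C)=Z^r_{\ell,n-\ell}/B^r_{\ell,n-\ell}$ for $r\ge1$, where $Z^r_{\ell,n-\ell}=\mathrm{Im}(H_n(F_\ell/F_{\ell-r})\to H_n(F_\ell/F_{\ell-1}))$ and $B^r_{\ell,n-\ell}=\mathrm{Ker}(H_n(F_\ell/F_{\ell-1})\to H_n(F_{\ell+r-1}/F_{\ell-1}))$. Intervals. An interval is a convex subset of $\mathbb R$. Every non-empty interval is uniquely $I=R_I\setminus L_I$ with $R_I=\{s\in\mathbb R\mid\exists i\in I,\ s\le i\}$ and $L_I=\{s\in\mathbb R\mid\forall i\in I,\ s<i\}$. For real $t\ge0$ put $I_{-t}=R_I\setminus(L_I-t)$ and $I^{+t}=(R_I+t)\setminus L_I$. Spectral homology. An $\mathbb R$-filtered chain complex $C$ has subcomplexes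 $F_sC$, $s\in\mathbb R$, with $F_sC\subseteq F_{s'}C$ for $s<s'$. For a downward closed $L\subseteq\mathbb R$ put $F_LC=\bigcup_{s\in L}F_sC$ (zero if $L=\emptyset$), and put $C_I=F_{R_I}C/F_{L_I}C$. Inclusions induce maps $C_{I_{-t}}\to C_I\to C_{I^{+t}}$. Set $\mathrm{SZ}^t_{n,I}(C)=\mathrm{Im}(H_n(C_{I_{-t}})\to H_n(C_I))$, $\mathrm{SB}^t_{n,I}(C)=\mathrm{Ker}(H_n(C_I)\to H_n(C_{I^{+t}}))\subseteq\mathrm{SZ}^t_{n,I}(C)$, and $\mathrm{SH}^t_{n,I}(C)=\mathrm{SZ}^t_{n,I}(C)/\mathrm{SB}^t_{n,I}(C)$. *)

theory Defs
  imports Complex_Main "HOL-Algebra.Module" "HOL-Algebra.AbelCoset"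
begin

section \<open>Quotient modules and maps between them\<close>

definition mod_hom ::
  "('k, 'q) ring_scheme \<Rightarrow> ('k, 'a) module \<Rightarrow> ('k, 'b) module \<Rightarrow> ('a \<Rightarrow> 'b) set" where
  "mod_hom K M N = {f. f \<in> carrier M \<rightarrow> carrier N
     \<and> (\<forall>x\<in>carrier M. \<forall>y\<in>carrier M. f (x \<oplus>\<^bsub>M\<^esub> y) = f x \<oplus>\<^bsub>N\<^esub> f y)
     \<and> (\<forall>a\<in>carrier K. \<forall>x\<in>carrier M. f (a \<odot>\<^bsub>M\<^esub> x) = a \<odot>\<^bsub>N\<^esub> f x)}"

text \<open>
  For a map \<open>f\<close> into \<open>M\<close>, the induced map from cosets of a submodule of its domain to cosets
  of \<open>N \<subseteq> M\<close>. If \<open>f\<close> descends to the quotients, all the cosets in the union coincide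
  (see \<open>coset_map_coset\<close> below).
\<close>
definition coset_map ::
  "('k, 'b) module \<Rightarrow> 'b set \<Rightarrow> ('a \<Rightarrow> 'b) \<Rightarrow> 'a set \<Rightarrow> 'b set" where
  "coset_map M N f X = (\<Union>x\<in>X. N +>\<^bsub>M\<^esub> f x)"

text \<open>
  The library's module records extend ring records; the axioms of a module do not mention the
  fields \<open>mult\<close> and \<open>one\<close>, which are left undefined here.
\<close>
definition quot_module :: "('k, 'a) module \<Rightarrow> 'a set \<Rightarrow> ('k, 'a set) module" where
  "quot_module M N =
     \<lparr>carrier = a_rcosets\<^bsub>M\<^esub> N, mult = undefined, one = undefined,
      zero = N, add = (\<lambda>X Y. X <+>\<^bsub>M\<^esub> Y),
      smult = (\<lambda>a. coset_map M N (\<lambda>x. a \<odot>\<^bsub>M\<^esub> x))\<rparr>"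

abbreviation restrict_module :: "('k, 'a) module \<Rightarrow> 'a set \<Rightarrow> ('k, 'a) module" where
  "restrict_module M N \<equiv> M\<lparr>carrier := N\<rparr>"


section \<open>Chain complexes and homology\<close>

text \<open>
  Chain complexes are graded by \<open>int\<close>; the differential \<open>diff C n\<close> goes from degree \<open>n\<close> to
  degree \<open>n - 1\<close>. The modules in the various degrees share the ambient type \<open>'a\<close>, but have
  unrelated carriers and operations.
\<close>
record ('k, 'a) chain_cplx =
  obj :: "int \<Rightarrow> ('k, 'a) module"
  diff :: "int \<Rightarrow> 'a \<Rightarrow> 'a"

locale chain_complex = cring K
  for K :: "('k, 'q) ring_scheme" (structure) and C :: "('k, 'a) chain_cplx" +
  assumes obj_module: "module K (obj C n)"
    and diff_hom: "diff C n \<in> mod_hom K (obj C n) (obj C (n - 1))"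
    and diff_diff: "x \<in> carrier (obj C n) \<Longrightarrow> diff C (n - 1) (diff C n x) = \<zero>\<^bsub>obj C (n - 2)\<^esub>"

definition subcomplex ::
  "('k, 'q) ring_scheme \<Rightarrow> ('k, 'a) chain_cplx \<Rightarrow> (int \<Rightarrow> 'a set) \<Rightarrow> bool" where
  "subcomplex K C D \<longleftrightarrow>
     (\<forall>n. submodule (D n) K (obj C n) \<and> diff C n ` D n \<subseteq> D (n - 1))"

text \<open>The complex \<open>D / D'\<close>, for subcomplexes \<open>D' \<subseteq> D\<close> of \<open>C\<close>.\<close>
definition subquotient ::
  "('k, 'a) chain_cplx \<Rightarrow> (int \<Rightarrow> 'a set) \<Rightarrow> (int \<Rightarrow> 'a set) \<Rightarrow> ('k, 'a set) chain_cplx" where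
  "subquotient C D D' =
     \<lparr>obj = (\<lambda>n. quot_module (restrict_module (obj C n) (D n)) (D' n)),
      diff = (\<lambda>n. coset_map (obj C (n - 1)) (D' (n - 1)) (diff C n))\<rparr>"

text \<open>
  The map \<open>D / D' \<rightarrow> E / E'\<close> induced by the inclusions \<open>D \<subseteq> E\<close> and \<open>D' \<subseteq> E'\<close>.
  On cosets it depends only on \<open>E'\<close>.
\<close>
definition inclusion_map ::
  "('k, 'a) chain_cplx \<Rightarrow> (int \<Rightarrow> 'a set) \<Rightarrow> int \<Rightarrow> 'a set \<Rightarrow> 'a set" where
  "inclusion_map C E' n = coset_map (obj C n) (E' n) (\<lambda>x. x)"

definition cycles :: "('k, 'a) chain_cplx \<Rightarrow> int \<Rightarrow> 'a set" where
  "cycles C n = a_kernel (obj C n) (obj C (n - 1)) (diff C n)"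

definition boundaries :: "('k, 'a) chain_cplx \<Rightarrow> int \<Rightarrow> 'a set" where
  "boundaries C n = diff C (n + 1) ` carrier (obj C (n + 1))"

definition homology :: "int \<Rightarrow> ('k, 'a) chain_cplx \<Rightarrow> ('k, 'a set) module" where
  "homology n C = quot_module (restrict_module (obj C n) (cycles C n)) (boundaries C n)"

text \<open>The map induced in homology by a chain map \<open>f\<close> with target \<open>D\<close>.\<close>
definition homology_map ::
  "int \<Rightarrow> ('k, 'b) chain_cplx \<Rightarrow> (int \<Rightarrow> 'a \<Rightarrow> 'b) \<Rightarrow> 'a set \<Rightarrow> 'b set" where
  "homology_map n D f = coset_map (obj D n) (boundaries D n) (f n)"


section \<open>The spectral sequence of an integer filtration\<close>

text \<open>A filtration assigns to an index \<open>l\<close> and a degree \<open>n\<close> the submodule \<open>F l n\<close>.\<close>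
locale Z_filtered_complex = chain_complex K C
  for K :: "('k, 'q) ring_scheme" (structure) and C :: "('k, 'a) chain_cplx" +
  fixes F :: "int \<Rightarrow> int \<Rightarrow> 'a set"
  assumes filt_subcomplex: "subcomplex K C (F l)"
    and filt_mono: "l \<le> l' \<Longrightarrow> F l n \<subseteq> F l' n"

definition page_Z ::
  "('k, 'a) chain_cplx \<Rightarrow> (int \<Rightarrow> int \<Rightarrow> 'a set) \<Rightarrow> nat \<Rightarrow> int \<Rightarrow> int \<Rightarrow> 'a set set set" where
  "page_Z C F r p q =
     homology_map (p + q) (subquotient C (F p) (F (p - 1))) (inclusion_map C (F (p - 1)))
       ` carrier (homology (p + q) (subquotient C (F p) (F (p - int r))))"

definition page_B ::
  "('k, 'a) chain_cplx \<Rightarrow> (int \<Rightarrow> int \<Rightarrow> 'a set) \<Rightarrow> nat \<Rightarrow> int \<Rightarrow> int \<Rightarrow> 'a set set set" where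
  "page_B C F r p q =
     a_kernel
       (homology (p + q) (subquotient C (F p) (F (p - 1))))
       (homology (p + q) (subquotient C (F (p + int r - 1)) (F (p - 1))))
       (homology_map (p + q) (subquotient C (F (p + int r - 1)) (F (p - 1)))
          (inclusion_map C (F (p - 1))))"

text \<open>The module in position \<open>(p, q)\<close> of the \<open>r\<close>-th page, for \<open>r \<ge> 1\<close>; its total degree is
  \<open>p + q\<close>.\<close>
definition page_E ::
  "('k, 'a) chain_cplx \<Rightarrow> (int \<Rightarrow> int \<Rightarrow> 'a set) \<Rightarrow> nat \<Rightarrow> int \<Rightarrow> int
     \<Rightarrow> ('k, 'a set set set) module" where
  "page_E C F r p q =
     quot_module
       (restrict_module (homology (p + q) (subquotient C (F p) (F (p - 1)))) (page_Z C F r p q))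
       (page_B C F r p q)"


section \<open>Spectral homology of a real filtration\<close>

locale R_filtered_complex = chain_complex K C
  for K :: "('k, 'q) ring_scheme" (structure) and C :: "('k, 'a) chain_cplx" +
  fixes F :: "real \<Rightarrow> int \<Rightarrow> 'a set"
  assumes filt_subcomplex: "subcomplex K C (F s)"
    and filt_mono: "s < s' \<Longrightarrow> F s n \<subseteq> F s' n"

definition real_filtration :: "(int \<Rightarrow> int \<Rightarrow> 'a set) \<Rightarrow> real \<Rightarrow> int \<Rightarrow> 'a set" where
  "real_filtration F s = F \<lfloor>s\<rfloor>"

text \<open>
  A non-empty interval is \<open>I = R\<^sub>I - L\<^sub>I\<close> for the downward closed sets \<open>R\<^sub>I = R_part I\<close> and
  \<open>L\<^sub>I = L_part I\<close>; \<open>extend_left t I\<close> is \<open>I\<close> with \<open>L\<^sub>I\<close> shifted by \<open>-t\<close>, and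
  \<open>extend_right t I\<close> is \<open>I\<close> with \<open>R\<^sub>I\<close> shifted by \<open>t\<close>, for \<open>t \<ge> 0\<close>.
\<close>
definition R_part :: "real set \<Rightarrow> real set" where
  "R_part I = {s. \<exists>i\<in>I. s \<le> i}"

definition L_part :: "real set \<Rightarrow> real set" where
  "L_part I = {s. \<forall>i\<in>I. s < i}"

definition extend_left :: "real \<Rightarrow> real set \<Rightarrow> real set" where
  "extend_left t I = R_part I - (\<lambda>s. s - t) ` L_part I"

definition extend_right :: "real \<Rightarrow> real set \<Rightarrow> real set" where
  "extend_right t I = (\<lambda>s. s + t) ` R_part I - L_part I"

definition filt_down ::
  "('k, 'a) chain_cplx \<Rightarrow> (real \<Rightarrow> int \<Rightarrow> 'a set) \<Rightarrow> real set \<Rightarrow> int \<Rightarrow> 'a set" where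
  "filt_down C F L n = (if L = {} then {\<zero>\<^bsub>obj C n\<^esub>} else \<Union>s\<in>L. F s n)"

definition interval_complex ::
  "('k, 'a) chain_cplx \<Rightarrow> (real \<Rightarrow> int \<Rightarrow> 'a set) \<Rightarrow> real set \<Rightarrow> ('k, 'a set) chain_cplx" where
  "interval_complex C F I =
     subquotient C (filt_down C F (R_part I)) (filt_down C F (L_part I))"

text \<open>The map \<open>H\<^sub>n(C\<^sub>I) \<rightarrow> H\<^sub>n(C\<^sub>J)\<close> induced by inclusions, for \<open>R\<^sub>I \<subseteq> R\<^sub>J\<close> and
  \<open>L\<^sub>I \<subseteq> L\<^sub>J\<close>; on cosets it depends only on \<open>J\<close>.\<close>
definition interval_homology_map ::
  "('k, 'a) chain_cplx \<Rightarrow> (real \<Rightarrow> int \<Rightarrow> 'a set) \<Rightarrow> int \<Rightarrow> real set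
     \<Rightarrow> 'a set set \<Rightarrow> 'a set set" where
  "interval_homology_map C F n J =
     homology_map n (interval_complex C F J) (inclusion_map C (filt_down C F (L_part J)))"

definition SZ ::
  "('k, 'a) chain_cplx \<Rightarrow> (real \<Rightarrow> int \<Rightarrow> 'a set) \<Rightarrow> real \<Rightarrow> int \<Rightarrow> real set \<Rightarrow> 'a set set set" where
  "SZ C F t n I =
     interval_homology_map C F n I ` carrier (homology n (interval_complex C F (extend_left t I)))"

definition SB ::
  "('k, 'a) chain_cplx \<Rightarrow> (real \<Rightarrow> int \<Rightarrow> 'a set) \<Rightarrow> real \<Rightarrow> int \<Rightarrow> real set \<Rightarrow> 'a set set set" where
  "SB C F t n I =
     a_kernel
       (homology n (interval_complex C F I))
       (homology n (interval_complex C F (extend_right t I)))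
       (interval_homology_map C F n (extend_right t I))"

definition SH ::
  "('k, 'a) chain_cplx \<Rightarrow> (real \<Rightarrow> int \<Rightarrow> 'a set) \<Rightarrow> real \<Rightarrow> int \<Rightarrow> real set
     \<Rightarrow> ('k, 'a set set set) module" where
  "SH C F t n I =
     quot_module
       (restrict_module (homology n (interval_complex C F I)) (SZ C F t n I))
       (SB C F t n I)"


section \<open>Consistency of the definitions\<close>

lemma coset_map_coset:
  assumes M: "abelian_group M" and N: "subgroup N (add_monoid M)"
    and M': "abelian_group M'" and N': "subgroup N' (add_monoid M')"
    and f: "f \<in> mod_hom K M M'" and fN: "f ` N \<subseteq> N'" and x: "x \<in> carrier M"
  shows "coset_map M' N' f (N +>\<^bsub>M\<^esub> x) = N' +>\<^bsub>M'\<^esub> f x"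
proof -
  interpret M: abelian_group M by fact
  interpret M': abelian_group M' by fact
  have NM: "N \<subseteq> carrier M" using subgroup.subset[OF N] by simp
  have N'M: "N' \<subseteq> carrier M'" using subgroup.subset[OF N'] by simp
  have N0: "\<zero>\<^bsub>M\<^esub> \<in> N" using subgroup.one_closed[OF N] by simp
  have *: "N' +>\<^bsub>M'\<^esub> f (h \<oplus>\<^bsub>M\<^esub> x) = N' +>\<^bsub>M'\<^esub> f x" if h: "h \<in> N" for h
  proof -
    have fx: "f x \<in> carrier M'" and fh: "f h \<in> N'" and eq: "f (h \<oplus>\<^bsub>M\<^esub> x) = f h \<oplus>\<^bsub>M'\<^esub> f x"
      using f fN h x NM unfolding mod_hom_def by blast+
    have "N' +>\<^bsub>M'\<^esub> f h = N'"
      using M'.add.coset_join2[OF _ N' fh] fh N'M by (auto simp: a_r_coset_def)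
    then show ?thesis
      using M'.a_coset_add_assoc[OF N'M, of "f h" "f x"] fh fx N'M by (auto simp: eq)
  qed
  have "coset_map M' N' f (N +>\<^bsub>M\<^esub> x) = (\<Union>h\<in>N. N' +>\<^bsub>M'\<^esub> f (h \<oplus>\<^bsub>M\<^esub> x))"
    by (auto simp: coset_map_def a_r_coset_def')
  also have "\<dots> = N' +>\<^bsub>M'\<^esub> f x"
    using * N0 by blast
  finally show ?thesis .
qed

lemma quot_module_smult:
  assumes M: "module K M" and N: "submodule N K M"
    and a: "a \<in> carrier K" and x: "x \<in> carrier M"
  shows "a \<odot>\<^bsub>quot_module M N\<^esub> (N +>\<^bsub>M\<^esub> x) = N +>\<^bsub>M\<^esub> (a \<odot>\<^bsub>M\<^esub> x)"
proof -
  interpret M: module K M by fact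
  interpret N: submodule N K M by fact
  have "(\<lambda>x. a \<odot>\<^bsub>M\<^esub> x) \<in> mod_hom K M M"
    using a by (auto simp: mod_hom_def M.smult_r_distr M.smult_assoc1[symmetric] M.R.m_comm)
  from coset_map_coset[OF M.abelian_group_axioms N.subgroup_axioms M.abelian_group_axioms
      N.subgroup_axioms this _ x]
  show ?thesis using a by (auto simp: quot_module_def)
qed

lemma module_quot_module:
  assumes M: "module K M" and N: "submodule N K M"
  shows "module K (quot_module M N)"
proof -
  interpret M: module K M by fact
  interpret N: submodule N K M by fact
  interpret S: abelian_subgroup N M
    by (rule abelian_subgroupI3)
       (auto intro: additive_subgroup.intro N.subgroup_axioms M.abelian_group_axioms)
  let ?Q = "quot_module M N"
  have carr: "X \<in> carrier ?Q \<longleftrightarrow> (\<exists>x\<in>carrier M. X = N +>\<^bsub>M\<^esub> x)" for X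
    by (auto simp: quot_module_def A_RCOSETS_def')
  have cl: "N +>\<^bsub>M\<^esub> x \<in> carrier ?Q" if "x \<in> carrier M" for x
    using that carr by blast
  have add: "(N +>\<^bsub>M\<^esub> x) \<oplus>\<^bsub>?Q\<^esub> (N +>\<^bsub>M\<^esub> y) = N +>\<^bsub>M\<^esub> (x \<oplus>\<^bsub>M\<^esub> y)"
    if "x \<in> carrier M" "y \<in> carrier M" for x y
    using that S.a_rcos_sum by (simp add: quot_module_def)
  have zero: "\<zero>\<^bsub>?Q\<^esub> = N +>\<^bsub>M\<^esub> \<zero>\<^bsub>M\<^esub>"
    using S.a_subset M.a_coset_add_zero by (simp add: quot_module_def)
  note sm = quot_module_smult[OF M N]
  show ?thesis
  proof (rule moduleI)
    show "abelian_group ?Q"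
    proof (rule abelian_groupI)
      fix X assume "X \<in> carrier ?Q"
      then obtain x where x: "x \<in> carrier M" "X = N +>\<^bsub>M\<^esub> x" using carr by blast
      have "(N +>\<^bsub>M\<^esub> (\<ominus>\<^bsub>M\<^esub> x)) \<oplus>\<^bsub>?Q\<^esub> X = \<zero>\<^bsub>?Q\<^esub>"
        using x by (simp add: add zero M.l_neg)
      then show "\<exists>Y\<in>carrier ?Q. Y \<oplus>\<^bsub>?Q\<^esub> X = \<zero>\<^bsub>?Q\<^esub>"
        using cl x(1) by blast
    qed (auto simp: carr add zero M.a_assoc M.a_comm M.a_lcomm)
  qed (auto simp: carr add sm M.is_cring M.smult_l_distr M.smult_r_distr M.smult_assoc1)
qed

lemma (in chain_complex) chain_complex_subquotient:
  assumes D: "subcomplex K C D" and D': "subcomplex K C D'" and le: "\<And>n. D' n \<subseteq> D n"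
  shows "chain_complex K (subquotient C D D')"
proof -
  let ?M = "\<lambda>n. restrict_module (obj C n) (D n)"
  let ?Q = "\<lambda>n. quot_module (?M n) (D' n)"
  have M: "module K (?M n)" for n
    using D obj_module submodule.submodule_is_module unfolding subcomplex_def by blast
  have sub: "submodule (D' n) K (?M n)" for n
    using D' le[of n] module.module_incl_imp_submodule[OF M, of "D' n" n]
      submodule.submodule_is_module[OF _ obj_module, of "D' n" n]
    unfolding subcomplex_def by simp
  have ag: "abelian_group (?M n)" and sg: "subgroup (D' n) (add_monoid (?M n))" for n
    using M[of n] sub[of n] by (auto simp: module_def submodule_def)
  have DC: "D n \<subseteq> carrier (obj C n)" for n
    using D module.submoduleE(1)[OF obj_module] unfolding subcomplex_def by blast
  have dh: "diff C n \<in> mod_hom K (?M n) (?M (n - 1))" for n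
  proof -
    have "diff C n ` D n \<subseteq> D (n - 1)"
      using D by (simp add: subcomplex_def)
    then show ?thesis
      using diff_hom[of n] DC[of n] by (auto simp: mod_hom_def subset_iff)
  qed
  have rc: "D' n +>\<^bsub>?M n\<^esub> x = D' n +>\<^bsub>obj C n\<^esub> x" for n x
    by (simp add: a_r_coset_def')
  have dc: "coset_map (obj C (n - 1)) (D' (n - 1)) (diff C n) (D' n +>\<^bsub>?M n\<^esub> x)
      = D' (n - 1) +>\<^bsub>?M (n - 1)\<^esub> diff C n x" if "x \<in> D n" for n x
    using coset_map_coset[OF ag sg ag sg dh, of n x] that D'
    by (simp add: subcomplex_def coset_map_def rc)
  have carr: "X \<in> carrier (?Q n) \<longleftrightarrow> (\<exists>x\<in>D n. X = D' n +>\<^bsub>?M n\<^esub> x)" for X n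
    by (auto simp: quot_module_def A_RCOSETS_def')
  have add: "(D' n +>\<^bsub>?M n\<^esub> x) \<oplus>\<^bsub>?Q n\<^esub> (D' n +>\<^bsub>?M n\<^esub> y) = D' n +>\<^bsub>?M n\<^esub> (x \<oplus>\<^bsub>?M n\<^esub> y)"
    if "x \<in> D n" "y \<in> D n" for x y n
  proof -
    interpret S: abelian_subgroup "D' n" "?M n"
      by (rule abelian_subgroupI3[OF additive_subgroup.intro[OF sg] ag])
    show ?thesis using that S.a_rcos_sum[of x y] by (simp add: quot_module_def)
  qed
  have Dadd: "x \<oplus>\<^bsub>?M n\<^esub> y \<in> D n" if "x \<in> D n" "y \<in> D n" for x y n
    using abelian_monoid.a_closed[OF abelian_group.axioms(1)[OF ag], of x n y] that by simp
  have Dsm: "a \<odot>\<^bsub>?M n\<^esub> x \<in> D n" if "a \<in> carrier K" "x \<in> D n" for a x n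
    using module.smult_closed[OF M, of a x n] that by simp
  have Dd: "diff C n x \<in> D (n - 1)" if "x \<in> D n" for x n
    using D that unfolding subcomplex_def by blast
  have hadd: "diff C n (x \<oplus>\<^bsub>?M n\<^esub> y) = diff C n x \<oplus>\<^bsub>?M (n - 1)\<^esub> diff C n y"
    if "x \<in> D n" "y \<in> D n" for x y n
    using dh[of n] that by (simp add: mod_hom_def)
  have hsm: "diff C n (a \<odot>\<^bsub>?M n\<^esub> x) = a \<odot>\<^bsub>?M (n - 1)\<^esub> diff C n x"
    if "a \<in> carrier K" "x \<in> D n" for a x n
    using dh[of n] that by (simp add: mod_hom_def)
  have sm: "a \<odot>\<^bsub>?Q n\<^esub> (D' n +>\<^bsub>?M n\<^esub> x) = D' n +>\<^bsub>?M n\<^esub> (a \<odot>\<^bsub>?M n\<^esub> x)"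
    if "a \<in> carrier K" "x \<in> D n" for a x n
    using quot_module_smult[OF M sub, of a x n] that by simp
  have 1: "module K (?Q n)" for n
    by (rule module_quot_module[OF M sub])
  have 2: "coset_map (obj C (n - 1)) (D' (n - 1)) (diff C n) \<in> mod_hom K (?Q n) (?Q (n - 1))" for n
    unfolding mod_hom_def mem_Collect_eq
  proof (intro conjI ballI funcsetI)
    fix X assume "X \<in> carrier (?Q n)"
    then obtain x where x: "x \<in> D n" "X = D' n +>\<^bsub>?M n\<^esub> x" using carr by blast
    show "coset_map (obj C (n - 1)) (D' (n - 1)) (diff C n) X \<in> carrier (?Q (n - 1))"
      unfolding x(2) dc[OF x(1)] carr using Dd[OF x(1)] by blast
    show "coset_map (obj C (n - 1)) (D' (n - 1)) (diff C n) (a \<odot>\<^bsub>?Q n\<^esub> X)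
      = a \<odot>\<^bsub>?Q (n - 1)\<^esub> coset_map (obj C (n - 1)) (D' (n - 1)) (diff C n) X"
      if a: "a \<in> carrier K" for a
      unfolding x(2) sm[OF a x(1)] dc[OF x(1)] dc[OF Dsm[OF a x(1)]] sm[OF a Dd[OF x(1)]]
        hsm[OF a x(1)] ..
    fix Y assume "Y \<in> carrier (?Q n)"
    then obtain y where y: "y \<in> D n" "Y = D' n +>\<^bsub>?M n\<^esub> y" using carr by blast
    show "coset_map (obj C (n - 1)) (D' (n - 1)) (diff C n) (X \<oplus>\<^bsub>?Q n\<^esub> Y)
      = coset_map (obj C (n - 1)) (D' (n - 1)) (diff C n) X
        \<oplus>\<^bsub>?Q (n - 1)\<^esub> coset_map (obj C (n - 1)) (D' (n - 1)) (diff C n) Y"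
      unfolding x(2) y(2) add[OF x(1) y(1)] dc[OF x(1)] dc[OF y(1)] dc[OF Dadd[OF x(1) y(1)]]
        add[OF Dd[OF x(1)] Dd[OF y(1)]] hadd[OF x(1) y(1)] ..
  qed
  have 3: "coset_map (obj C (n - 1 - 1)) (D' (n - 1 - 1)) (diff C (n - 1))
      (coset_map (obj C (n - 1)) (D' (n - 1)) (diff C n) X) = \<zero>\<^bsub>?Q (n - 2)\<^esub>"
    if "X \<in> carrier (?Q n)" for X n
  proof -
    from that obtain x where x: "x \<in> D n" "X = D' n +>\<^bsub>?M n\<^esub> x" using carr by blast
    have dd: "diff C (n - 1) (diff C n x) = \<zero>\<^bsub>obj C (n - 2)\<^esub>"
      using diff_diff x(1) DC by blast
    interpret m: module K "obj C (n - 2)" by (rule obj_module)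
    have "D' (n - 2) +>\<^bsub>?M (n - 2)\<^esub> \<zero>\<^bsub>obj C (n - 2)\<^esub> = D' (n - 2)"
      unfolding rc using m.a_coset_add_zero DC[of "n - 2"] le[of "n - 2"] by auto
    then show ?thesis
      unfolding x(2) dc[OF x(1)] dc[OF Dd[OF x(1)]] dd by (simp add: quot_module_def)
  qed
  show ?thesis
  proof (intro chain_complex.intro chain_complex_axioms.intro cring_axioms)
    show "module K (obj (subquotient C D D') n)" for n
      using 1[of n] by (simp only: subquotient_def chain_cplx.simps)
    show "diff (subquotient C D D') n
        \<in> mod_hom K (obj (subquotient C D D') n) (obj (subquotient C D D') (n - 1))" for n
      using 2[of n] by (simp only: subquotient_def chain_cplx.simps)
    show "diff (subquotient C D D') (n - 1) (diff (subquotient C D D') n X)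
        = \<zero>\<^bsub>obj (subquotient C D D') (n - 2)\<^esub>"
      if "X \<in> carrier (obj (subquotient C D D') n)" for X n
      using 3[of X n] that by (simp only: subquotient_def chain_cplx.simps)
  qed
qed

lemma (in Z_filtered_complex) real_filtration:
  "R_filtered_complex K C (real_filtration F)"
proof (unfold_locales)
  show "subcomplex K C (real_filtration F s)" for s
    by (simp add: real_filtration_def filt_subcomplex)
  show "real_filtration F s n \<subseteq> real_filtration F s' n" if "s < s'" for s s' n
    using filt_mono[OF floor_mono[of s s']] that by (simp add: real_filtration_def)
qed

end

theory Submission
  imports Defs
begin

text \<open>
  All three modules are built by the same formula from subquotients \<open>F\<^sub>a / F\<^sub>b\<close> of \<open>C\<close>: the
  homology of the middle one, \<open>F\<^sub>l / F\<^sub>l\<^sub>-\<^sub>1\<close>, an image from one with smaller \<open>b\<close>, and a kernel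
  towards one with larger \<open>a\<close>. So it suffices that the same steps of the filtration occur; the
  modules are then equal, not just isomorphic.

  For \<open>t \<ge> 0\<close>, the two ends of \<open>extend_left t I\<close> are \<open>R\<^sub>I\<close> and \<open>L\<^sub>I - t\<close>, and those of
  \<open>extend_right t I\<close> are \<open>R\<^sub>I + t\<close> and \<open>L\<^sub>I\<close>. Both \<open>(l - 1, l]\<close> and \<open>{l}\<close> have the right end
  \<open>(-\<infinity>, l]\<close>; their left ends \<open>(-\<infinity>, l - 1]\<close> and \<open>(-\<infinity>, l)\<close> differ, but \<open>l - 1\<close> is the largest
  integer in either of them, and the largest integer in a downward closed set is all that a
  filtration with \<open>F\<^sub>s = F\<^bsub>\<lfloor>s\<rfloor>\<^esub>\<close> sees of it (\<open>filt_down_real_filtration\<close>). Shifting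
  by the integer \<open>t = r - 1\<close> shifts this largest integer by the same amount, which turns
  \<open>l - 1\<close> into \<open>l - r\<close> and \<open>l\<close> into \<open>l + r - 1\<close>, as in the definition of the \<open>r\<close>-th page.
\<close>

lemma R_part_extend_left:
  assumes "t \<ge> 0"
  shows "R_part (extend_left t I) = R_part I"
proof -
  have "I \<subseteq> extend_left t I"
    using assms by (force simp: extend_left_def R_part_def L_part_def)
  then show ?thesis
    by (fastforce simp: extend_left_def R_part_def)
qed

text \<open>
  A point outside \<open>L\<^sub>I - t\<close> that lies below all of \<open>R\<^sub>I - (L\<^sub>I - t)\<close>, hence below all of \<open>I\<close>,
  would belong to \<open>R\<^sub>I - (L\<^sub>I - t)\<close> and lie below itself; here \<open>I\<close> is non-empty, since \<open>L\<^sub>I - t\<close>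
  is not the whole line.
\<close>
lemma L_part_extend_left:
  assumes "t \<ge> 0"
  shows "L_part (extend_left t I) = (\<lambda>s. s - t) ` L_part I"
proof
  show "L_part (extend_left t I) \<subseteq> (\<lambda>s. s - t) ` L_part I"
  proof (rule subsetI, rule ccontr)
    fix s assume s: "s \<in> L_part (extend_left t I)" "s \<notin> (\<lambda>s. s - t) ` L_part I"
    have "s + t \<notin> L_part I"
      using s(2) by (metis add_diff_cancel_right' image_eqI)
    then obtain i where i: "i \<in> I" by (auto simp: L_part_def)
    have "i \<in> extend_left t I"
      using i assms by (force simp: extend_left_def R_part_def L_part_def)
    then have "s \<in> R_part I"
      using s(1) i by (auto simp: L_part_def R_part_def intro!: bexI[of _ i])
    then have "s \<in> extend_left t I"
      using s(2) by (simp add: extend_left_def)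
    then show False using s(1) by (auto simp: L_part_def)
  qed
  show "(\<lambda>s. s - t) ` L_part I \<subseteq> L_part (extend_left t I)"
  proof clarify
    fix s assume s: "s \<in> L_part I"
    have "s - t < j" if "j \<in> extend_left t I" for j
    proof (rule ccontr)
      assume "\<not> s - t < j"
      then have "j + t \<in> L_part I"
        using s by (fastforce simp: L_part_def)
      then have "j \<in> (\<lambda>s. s - t) ` L_part I"
        by (intro image_eqI[of _ _ "j + t"]) auto
      then show False using that by (simp add: extend_left_def)
    qed
    then show "s - t \<in> L_part (extend_left t I)"
      by (simp add: L_part_def)
  qed
qed

lemma R_part_extend_right:
  assumes "t \<ge> 0"
  shows "R_part (extend_right t I) = (\<lambda>s. s + t) ` R_part I"
proof
  show "R_part (extend_right t I) \<subseteq> (\<lambda>s. s + t) ` R_part I"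
  proof
    fix s assume "s \<in> R_part (extend_right t I)"
    then obtain u i where "i \<in> I" "u \<le> i" "s \<le> u + t"
      by (auto simp: extend_right_def R_part_def)
    then show "s \<in> (\<lambda>s. s + t) ` R_part I"
      by (intro image_eqI[of _ _ "s - t"]) (auto simp: R_part_def intro!: bexI[of _ i])
  qed
  have "i + t \<in> extend_right t I" if "i \<in> I" for i
  proof -
    have "i + t \<in> (\<lambda>s. s + t) ` R_part I"
      using that by (auto simp: R_part_def)
    moreover have "i + t \<notin> L_part I"
      using that assms by (force simp: L_part_def)
    ultimately show ?thesis by (simp add: extend_right_def)
  qed
  then show "(\<lambda>s. s + t) ` R_part I \<subseteq> R_part (extend_right t I)"
    by (auto simp: R_part_def intro: add_right_mono bexI[rotated])
qed

lemma L_part_extend_right: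
  assumes "t \<ge> 0"
  shows "L_part (extend_right t I) = L_part I"
proof -
  have "I \<subseteq> extend_right t I"
  proof
    fix i assume "i \<in> I"
    then show "i \<in> extend_right t I"
      using assms
      by (auto simp: extend_right_def R_part_def L_part_def intro!: image_eqI[of _ _ "i - t"] bexI[of _ i])
  qed
  moreover have "s < j" if "s \<in> L_part I" "j \<in> extend_right t I" for s j
    using that by (force simp: extend_right_def L_part_def)
  ultimately show ?thesis
    by (auto simp: L_part_def)
qed

context Z_filtered_complex
begin

lemma filt_down_real_filtration:
  assumes "real_of_int k \<in> L" and "\<And>s. s \<in> L \<Longrightarrow> s < real_of_int k + 1"
  shows "filt_down C (real_filtration F) L = F k"
proof
  fix n
  have "F \<lfloor>s\<rfloor> n \<subseteq> F k n" if "s \<in> L" for s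
    using assms(2)[OF that] by (intro filt_mono) linarith
  moreover have "F k n \<subseteq> (\<Union>s\<in>L. F \<lfloor>s\<rfloor> n)"
    using assms(1) by force
  ultimately show "filt_down C (real_filtration F) L n = F k n"
    using assms(1) by (auto simp: filt_down_def real_filtration_def)
qed

text \<open>
  The hypotheses on \<open>L_part I\<close> say that \<open>l - 1\<close> is its largest integer. They leave open whether
  the non-integers between \<open>l - 1\<close> and \<open>l\<close> belong to \<open>L_part I\<close> or to \<open>I\<close>, which is the
  difference between \<open>{l}\<close> and \<open>(l - 1, l]\<close>.
\<close>
lemma page_E_eq_SH:
  assumes r: "r \<ge> 1" and R: "R_part I = {..real_of_int l}"
    and L: "real_of_int l - 1 \<in> L_part I" "L_part I \<subseteq> {..<real_of_int l}"
  shows "page_E C F r l (n - l) = SH C (real_filtration F) (real r - 1) n I"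
proof -
  let ?t = "real r - 1" and ?D = "filt_down C (real_filtration F)"
  have t: "?t \<ge> 0" using r by simp
  have DR: "?D (R_part I) = F l"
    by (rule filt_down_real_filtration) (auto simp: R)
  have DL: "?D (L_part I) = F (l - 1)"
    using L by (intro filt_down_real_filtration) auto
  have DL': "?D (L_part (extend_left ?t I)) = F (l - int r)"
    unfolding L_part_extend_left[OF t]
  proof (rule filt_down_real_filtration)
    show "real_of_int (l - int r) \<in> (\<lambda>s. s - ?t) ` L_part I"
      using L(1) by (rule rev_image_eqI) simp
  qed (use L(2) in auto)
  have DR': "?D (R_part (extend_right ?t I)) = F (l + int r - 1)"
    unfolding R_part_extend_right[OF t] R
  proof (rule filt_down_real_filtration)
    show "real_of_int (l + int r - 1) \<in> (\<lambda>s. s + ?t) ` {..real_of_int l}"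
      by (rule image_eqI[of _ _ "real_of_int l"]) auto
  qed auto
  show ?thesis
    by (simp add: page_E_def page_Z_def page_B_def SH_def SZ_def SB_def interval_complex_def
        interval_homology_map_def R_part_extend_left[OF t] L_part_extend_right[OF t]
        DR DL DL' DR')
qed

end

theorem proposition4p4:
  fixes K :: "('k, 'q) ring_scheme" and C :: "('k, 'a) chain_cplx"
    and F :: "int \<Rightarrow> int \<Rightarrow> 'a set" and r :: nat and l n :: int
  assumes "Z_filtered_complex K C F" and "r \<ge> 1"
  shows "page_E C F r l (n - l) = SH C (real_filtration F) (real r - 1) n {real_of_int l - 1<..real_of_int l}
    \<and> SH C (real_filtration F) (real r - 1) n {real_of_int l - 1<..real_of_int l}
        = SH C (real_filtration F) (real r - 1) n {real_of_int l}"
proof -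
  interpret Z_filtered_complex K C F by fact
  let ?l = "real_of_int l"
  have R: "R_part {?l - 1<..?l} = {..?l}"
    by (auto simp: R_part_def intro!: bexI[of _ ?l])
  have "?l - 1 \<in> L_part {?l - 1<..?l}" "L_part {?l - 1<..?l} \<subseteq> {..<?l}"
    by (auto simp: L_part_def)
  note half_open = page_E_eq_SH[OF assms(2) R this, of n]
  have R: "R_part {?l} = {..?l}"
    by (auto simp: R_part_def)
  have "?l - 1 \<in> L_part {?l}" "L_part {?l} \<subseteq> {..<?l}"
    by (auto simp: L_part_def)
  note point = page_E_eq_SH[OF assms(2) R this, of n]
  show ?thesis
    using half_open point by simp
qed

end
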